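(* Let $q$ be a power of an odd prime and write $N=q+1=2^mp_1^{e_1}\cdots p_s^{e_s}$, where $p_1,\dots,p_s$ are pairwise distinct odd primes and $m,e_1,\dots,e_s$ are positive integers. Define $$E_q(B,C)=\operatorname{lcm}\big(\mathcal V_{\frac{N}{2p_1}}(B,C),\dots,\mathcal V_{\frac{N}{2p_s}}(B,C)\big).$$ Let $f(X)=X^2+bX+c\in\mathbb F_q[X]$ be an irreducible quadratic polynomial, where $c$ is a primitive element of $\mathbb F_q$. Then $f(X)$ is primitive if and only if $E_q(b,c)\ne 0$.
   Context: A primitive element of $\mathbb F_q$ is a generator of $\mathbb F_q^*$. A monic quadratic polynomial over $\mathbb F_q$ is primitive if it is the minimal polynomial over $\mathbb F_q$ of a generator of $\mathbb F_{q^2}^*$. Let $B,C$ be algebraically independent indeterminates over $\mathbb F_q$. The Lucas polynomials of the second type are defined by $\mathcal V_0=2$, $\mathcal V_1=-B$, $\mathcal V_n=-B\,\mathcal V_{n-1}-C\,\mathcal V_{n-2}$ for $n\ge2$. The lcm is the least common multiple in $\mathbb F_q[B,C]$, normalized to be monic with respect to $B$; the empty lcm (case $s=0$) is $1$. *)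

theory Defs
  imports
    "HOL-Algebra.Algebraic_Closure_Type"
    "HOL-Computational_Algebra.Computational_Algebra"
    "HOL-Library.Cardinality"
begin

definition generates_units :: "'k::field set \<Rightarrow> 'k \<Rightarrow> bool"
  where "generates_units K g \<longleftrightarrow> range (\<lambda>n::int. g powi n) = K - {0}"

abbreviation primitive_element :: "'a::field \<Rightarrow> bool"
  where "primitive_element g \<equiv> generates_units UNIV g"

text \<open>
  The degree-two extension of a field with \<open>q\<close> elements, realised as the subfield of its
  algebraic closure that consists of the roots of \<open>X ^ q\<^sup>2 - X\<close>.
\<close>
definition quadratic_ext :: "'a::finite_field alg_closure set"
  where "quadratic_ext = {x. x ^ (CARD('a)\<^sup>2) = x}"

definition is_minimal_poly :: "'a::field poly \<Rightarrow> 'a alg_closure \<Rightarrow> bool"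
  where "is_minimal_poly f x \<longleftrightarrow>
    lead_coeff f = 1 \<and> poly (map_poly to_ac f) x = 0 \<and>
    (\<forall>g. g \<noteq> 0 \<and> poly (map_poly to_ac g) x = 0 \<longrightarrow> degree f \<le> degree g)"

definition primitive_quadratic :: "'a::finite_field poly \<Rightarrow> bool"
  where "primitive_quadratic f \<longleftrightarrow>
    lead_coeff f = 1 \<and> degree f = 2 \<and>
    (\<exists>x. generates_units quadratic_ext x \<and> is_minimal_poly f x)"

text \<open>
  The ring of polynomials in \<open>B\<close>, \<open>C\<close> is \<^typ>\<open>'a poly poly\<close>, with \<open>B\<close> as the outer and \<open>C\<close> as
  the inner indeterminate, so that degrees and leading coefficients on the outer level are taken
  with respect to \<open>B\<close>.
\<close>
abbreviation B_var :: "'a::comm_ring_1 poly poly"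
  where "B_var \<equiv> [:0, 1:]"

abbreviation C_var :: "'a::comm_ring_1 poly poly"
  where "C_var \<equiv> [:[:0, 1:]:]"

fun lucas_V :: "nat \<Rightarrow> 'a::comm_ring_1 poly poly"
  where
    "lucas_V 0 = 2"
  | "lucas_V (Suc 0) = - B_var"
  | "lucas_V (Suc (Suc n)) = - B_var * lucas_V (Suc n) - C_var * lucas_V n"

definition eval2 :: "'a::comm_ring_1 poly poly \<Rightarrow> 'a \<Rightarrow> 'a \<Rightarrow> 'a"
  where "eval2 F b c = poly (poly F [:b:]) c"

text \<open>
  Every field carries the operations of class \<^class>\<open>field_gcd\<close>; they only provide the
  library's \<^const>\<open>Lcm\<close> on polynomials.  That \<^const>\<open>Lcm\<close> is normalized, which here means monic
  with respect to \<open>B\<close>, see \<open>lead_coeff_E_poly\<close> below.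
\<close>
definition E_poly :: "nat \<Rightarrow> (nat \<Rightarrow> nat) \<Rightarrow> nat \<Rightarrow> 'a::field_gcd poly poly"
  where "E_poly N p s = Lcm ((\<lambda>i. lucas_V (N div (2 * p i))) ` {1..s})"

lemma lucas_V_Suc_degree:
  "degree (lucas_V (Suc n) :: 'a::field poly poly) = Suc n \<and>
   coeff (lucas_V (Suc n) :: 'a poly poly) (Suc n) = (-1) ^ Suc n"
proof (induction n rule: less_induct)
  case (less n)
  show ?case
  proof (cases n)
    case 0
    then show ?thesis by simp
  next
    case (Suc k)
    let ?V = "lucas_V :: nat \<Rightarrow> 'a poly poly"
    have IH: "degree (?V n) = n" "coeff (?V n) n = (-1) ^ n"
      using less.IH[of k] Suc by simp_all
    have nz: "?V n \<noteq> 0" using IH(2) by auto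
    have rec: "?V (Suc n) = - pCons 0 (?V n) - smult [:0, 1:] (?V k)"
      using Suc by simp
    have "degree (?V k) \<le> k"
    proof (cases k)
      case 0
      have "degree (2 :: 'a poly poly) = 0"
        by (metis degree_numeral)
      then show ?thesis using 0 by simp
    next
      case (Suc j)
      then show ?thesis using less.IH[of j] \<open>n = Suc k\<close> by simp
    qed
    then have small: "degree (smult [:0, 1:] (?V k)) < Suc n"
      using Suc by (metis degree_smult_le le_imp_less_Suc le_SucI order_trans)
    have big: "degree (- pCons 0 (?V n)) = Suc n"
      using nz IH(1) by simp
    have deg: "degree (?V (Suc n)) = Suc n"
      unfolding rec diff_conv_add_uminus
      using small big by (subst degree_add_eq_left) simp_all
    have "coeff (?V (Suc n)) (Suc n) = - coeff (?V n) n - coeff (smult [:0, 1:] (?V k)) (Suc n)"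
      unfolding rec by simp
    also have "coeff (smult [:0, 1:] (?V k)) (Suc n) = 0"
      using small by (rule coeff_eq_0)
    also have "- coeff (?V n) n - 0 = (-1) ^ Suc n"
      using IH by simp
    finally show ?thesis using deg by simp
  qed
qed

lemma lead_coeff_E_poly:
  assumes "\<And>i. i \<in> {1..s} \<Longrightarrow> 0 < N div (2 * p i)"
  shows "lead_coeff (E_poly N p s :: 'a::field_gcd poly poly) = 1"
proof -
  let ?A = "(\<lambda>i. lucas_V (N div (2 * p i)) :: 'a poly poly) ` {1..s}"
  let ?E = "E_poly N p s :: 'a poly poly"
  have unit: "lead_coeff v dvd 1" if v: "v \<in> ?A" for v
  proof -
    obtain i where "i \<in> {1..s}" "v = lucas_V (N div (2 * p i))"
      using v by auto
    with assms[of i] obtain n where "v = lucas_V (Suc n)"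
      by (metis gr0_implies_Suc)
    then have "lead_coeff v = (-1) ^ Suc n"
      using lucas_V_Suc_degree[of n, where 'a = 'a] by simp
    then show ?thesis by (simp add: is_unit_power_iff)
  qed
  have "?E dvd \<Prod>?A"
    unfolding E_poly_def by (intro Lcm_least dvd_prodI) auto
  then have "lead_coeff ?E dvd lead_coeff (\<Prod>?A)"
    by (metis dvd_def lead_coeff_mult)
  also have "lead_coeff (\<Prod>?A) = (\<Prod>v\<in>?A. lead_coeff v)"
    by (simp add: lead_coeff_prod)
  also have "\<dots> dvd (\<Prod>v\<in>?A. 1)"
    using unit by (intro prod_dvd_prod) auto
  finally have u: "lead_coeff ?E dvd 1" by simp
  have "normalize ?E = ?E" by (simp add: E_poly_def)
  then have "lead_coeff ?E = lead_coeff ?E div unit_factor (lead_coeff ?E)"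
    by (metis coeff_normalize)
  with u show ?thesis
    by (metis is_unit_unit_factor div_self not_is_unit_0)
qed

lemma card_quadratic_ext: "card (quadratic_ext :: 'a::finite_field alg_closure set) = CARD('a)\<^sup>2"
proof -
  let ?n = "CARD('a)\<^sup>2"
  let ?P = "monom 1 ?n - monom 1 1 :: 'a alg_closure poly"
  have "card {0, 1 :: 'a} \<le> CARD('a)" by (intro card_mono) auto
  then have q: "CARD('a) > 1" by simp
  then have n: "?n > 1" by (intro one_less_power) auto
  have "of_nat CARD('a) = (0 :: 'a)"
  proof -
    have "(\<Sum>x\<in>UNIV. x + 1 :: 'a) = (\<Sum>x\<in>UNIV. x)"
      by (rule sum.reindex_bij_witness[of _ "\<lambda>x. x - 1" "\<lambda>x. x + 1"]) auto
    then show ?thesis by (simp add: sum.distrib)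
  qed
  then have q0: "of_nat CARD('a) = (0 :: 'a alg_closure)"
    by (metis to_ac_0 to_ac_of_nat)
  have deg: "degree ?P = ?n"
    using n unfolding diff_conv_add_uminus
    by (subst degree_add_eq_left) (simp_all add: degree_monom_eq)
  then have nz: "?P \<noteq> 0" using n by auto
  have pd: "pderiv ?P = - 1"
    by (simp add: pderiv_diff pderiv_monom q0 power2_eq_square)
  obtain A where A: "size A = ?n" "?P = smult (lead_coeff ?P) (\<Prod>x\<in>#A. [:- x, 1:])"
    using alg_closed_imp_factorization[OF nz] deg by auto
  define l where "l = lead_coeff ?P"
  have l: "l \<noteq> 0" using nz unfolding l_def leading_coeff_0_iff .
  have P: "?P = smult l (\<Prod>x\<in>#A. [:- x, 1:])" using A(2) unfolding l_def .
  have le1: "count A x \<le> 1" for x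
  proof (rule ccontr)
    assume "\<not> count A x \<le> 1"
    then have "{#x, x#} \<subseteq># A" by (simp add: subseteq_mset_def)
    then obtain A' where "A = {#x, x#} + A'" by (metis subset_mset.le_iff_add)
    define R where "R = smult l (\<Prod>x\<in>#A'. [:- x, 1:])"
    have "smult l (\<Prod>x\<in>#A. [:- x, 1:]) = [:- x, 1:] * ([:- x, 1:] * R)"
      unfolding R_def \<open>A = _\<close>
      by (simp only: image_mset_union image_mset_add_mset image_mset_empty prod_mset.union
        prod_mset.add_mset prod_mset.empty mult_smult_right mult.assoc mult_1)
    with P have "?P = [:- x, 1:] * ([:- x, 1:] * R)" by (rule trans)
    then have "poly (pderiv ?P) x = 0" by (simp only: pderiv_mult) simp
    then show False unfolding pd by simp
  qed
  have "set_mset A = quadratic_ext"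
  proof (rule Set.set_eqI)
    fix x
    have "x \<in> quadratic_ext \<longleftrightarrow> poly ?P x = 0"
      by (simp add: quadratic_ext_def poly_monom)
    also have "\<dots> \<longleftrightarrow> x \<in># A"
      unfolding P using l by (auto simp: poly_prod_mset prod_mset_zero_iff)
    finally show "x \<in># A \<longleftrightarrow> x \<in> quadratic_ext" by simp
  qed
  moreover have "card (set_mset A) = size A"
  proof -
    have "size A = (\<Sum>x\<in>set_mset A. count A x)" by (rule size_multiset_overloaded_eq)
    also have "\<dots> = (\<Sum>x\<in>set_mset A. 1)"
      using le1 by (intro sum.cong) (auto intro!: antisym simp: Suc_le_eq)
    finally show ?thesis by simp
  qed
  ultimately show ?thesis using A(1) by simp
qed

end

theory Submission
  imports Defs "HOL-Number_Theory.Residues"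
begin

text \<open>
  Let \<open>x\<close> be a root of \<open>f\<close>.  The other root is \<open>x ^ q\<close>, so \<open>x ^ (q + 1) = c\<close> and
  \<open>V\<^sub>n(b, c) = x ^ n + x ^ (q * n)\<close>.  The order of \<open>x\<close> divides \<open>q\<^sup>2 - 1\<close>, and since \<open>c\<close> is
  primitive, no prime divisor of \<open>q - 1\<close> divides the index.  It remains to test the odd primes
  \<open>p\<close> dividing \<open>q + 1\<close>.  For \<open>y = x ^ ((q\<^sup>2 - 1) / (2 * p))\<close> one has
  \<open>y ^ p = c ^ ((q - 1) / 2) = -1\<close>, so \<open>y\<^sup>2 = 1\<close> forces \<open>y = -1\<close>, and this is exactly the
  vanishing of \<open>V\<^sub>n(b, c) = x ^ n * (1 + y)\<close> at \<open>n = (q + 1) / (2 * p)\<close>.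
\<close>

section \<open>Orders of elements and generators of finite unit groups\<close>

lemma card_range_powi_eq_iff:
  fixes x :: "'k::field"
  assumes "n > 0" "x ^ n = 1"
  shows "card (range (\<lambda>i::int. x powi i)) = n \<longleftrightarrow>
    (\<forall>l. prime l \<and> l dvd n \<longrightarrow> x ^ (n div l) \<noteq> 1)"
proof -
  have x0: "x \<noteq> 0" using assms by (metis power_0_left less_numeral_extra(3) zero_neq_one)
  \<comment> \<open>\<open>d\<close> is the order of \<open>x\<close>. The powers with exponents
    below \<open>d\<close> are distinct and exhaust the cyclic group generated by \<open>x\<close>,
    so the cardinality in question is \<open>d\<close>, a divisor of \<open>n\<close>.\<close>
  define d where "d = (LEAST d. d > 0 \<and> x ^ d = 1)"
  have d: "d > 0" "x ^ d = 1"
    using LeastI[of "\<lambda>d. d > 0 \<and> x ^ d = 1" n] assms unfolding d_def by auto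
  have d_min: "d \<le> j" if "j > 0" "x ^ j = 1" for j
    unfolding d_def using that by (intro Least_le) auto
  have mod_d: "x ^ j = x ^ (j mod d)" for j
  proof -
    have "x ^ j = x ^ (d * (j div d) + j mod d)" by simp
    also have "\<dots> = x ^ (j mod d)" using d(2) by (simp only: power_add power_mult) simp
    finally show ?thesis .
  qed
  have dvd_iff: "x ^ j = 1 \<longleftrightarrow> d dvd j" for j
    using mod_d[of j] d_min[of "j mod d"] d(1)
    by (metis dvd_eq_mod_eq_0 mod_less_divisor neq0_conv not_le power_0)
  have inj: "inj_on (\<lambda>j. x ^ j) {..<d}"
  proof (rule linorder_inj_onI)
    fix i j assume ij: "i < j" "i \<in> {..<d}" "j \<in> {..<d}"
    show "x ^ i \<noteq> x ^ j"
    proof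
      assume "x ^ i = x ^ j"
      moreover have "x ^ j = x ^ i * x ^ (j - i)" using ij by (simp flip: power_add)
      ultimately have "x ^ (j - i) = 1" using x0 by simp
      then show False using d_min[of "j - i"] ij by auto
    qed
  qed auto
  have "range (\<lambda>i::int. x powi i) = (\<lambda>j. x ^ j) ` {..<d}"
  proof (intro equalityI subsetI)
    fix y assume "y \<in> range (\<lambda>i::int. x powi i)"
    then obtain i :: int where y: "y = x powi i" by auto
    have period: "x powi (int d * t + u) = x powi u" for t u
      using x0 d(2) by (simp add: power_int_add power_int_mult)
    \<comment> \<open>The remainder modulo \<open>int d\<close> is nonnegative, so negative
      exponents are turned into natural ones.\<close>
    have "y = x powi (int d * (i div int d) + i mod int d)" using y by simp
    also have "\<dots> = x powi (i mod int d)" by (rule period)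
    also have "\<dots> = x ^ nat (i mod int d)"
      using d(1) by (simp add: power_int_def)
    finally have "y = x ^ nat (i mod int d)" .
    moreover have "nat (i mod int d) < d" using d(1) by (simp add: nat_less_iff)
    ultimately show "y \<in> (\<lambda>j. x ^ j) ` {..<d}" by blast
  next
    fix y assume "y \<in> (\<lambda>j. x ^ j) ` {..<d}"
    then show "y \<in> range (\<lambda>i::int. x powi i)" by (auto simp flip: power_int_of_nat)
  qed
  then have card: "card (range (\<lambda>i::int. x powi i)) = d"
    using inj by (simp add: card_image)
  have dn: "d dvd n" using assms dvd_iff by simp
  show ?thesis unfolding card dvd_iff
  proof (intro iffI allI impI notI)
    fix l assume "d = n" "prime l \<and> l dvd n" "d dvd n div l"
    then show False
      using assms(1) prime_gt_1_nat[of l] div_less_dividend[of l n]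
        dvd_imp_le[of n "n div l"] dvd_div_eq_0_iff[of l n]
      by auto
  next
    assume A: "\<forall>l. prime l \<and> l dvd n \<longrightarrow> \<not> d dvd n div l"
    \<comment> \<open>If the cofactor \<open>t\<close> of the order in \<open>n\<close> is not 1,
      any prime \<open>l\<close> dividing \<open>t\<close> can be removed from \<open>n\<close> with
      the rest still a multiple of \<open>d\<close>, contradicting \<open>A\<close>.\<close>
    obtain t where t: "n = d * t" using dn by blast
    show "d = n"
    proof (rule ccontr)
      assume "d \<noteq> n"
      then have "t \<noteq> 1" using t by auto
      then obtain l where l: "prime l" "l dvd t" using prime_factor_nat by blast
      then obtain u where "t = l * u" by blast
      then have "n div l = d * u" using t prime_gt_0_nat[OF l(1)] by simp
      then have "d dvd n div l" by simp
      then show False using A l t by (metis dvd_mult)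
    qed
  qed
qed

text \<open>The powers of \<open>x\<close> lie inside \<open>K - {0}\<close>, so exhausting it is a
  matter of counting. The bound \<open>n > 0\<close> makes \<open>K - {0}\<close> finite, because
  \<open>card\<close> of an infinite set is 0.\<close>

lemma generates_units_iff:
  fixes x :: "'k::field"
  assumes "card (K - {0}) = n" "n > 0" "x ^ n = 1" "range (\<lambda>i::int. x powi i) \<subseteq> K - {0}"
  shows "generates_units K x \<longleftrightarrow> (\<forall>l. prime l \<and> l dvd n \<longrightarrow> x ^ (n div l) \<noteq> 1)"
proof -
  have "finite (K - {0})" using assms(1,2) by (metis card_ge_0_finite)
  then have "generates_units K x \<longleftrightarrow> card (range (\<lambda>i::int. x powi i)) = n"
    unfolding generates_units_def using assms by (metis card_subset_eq)
  then show ?thesis using card_range_powi_eq_iff[OF assms(2,3)] by simp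
qed

lemma one_less_card_field: "1 < CARD('a::finite_field)"
proof -
  have "card {0, 1 :: 'a} \<le> CARD('a)" by (intro card_mono) auto
  then show ?thesis by simp
qed

lemma primitive_element_iff:
  fixes c :: "'a::finite_field"
  assumes "c \<noteq> 0"
  shows "primitive_element c \<longleftrightarrow>
    (\<forall>l. prime l \<and> l dvd CARD('a) - 1 \<longrightarrow> c ^ ((CARD('a) - 1) div l) \<noteq> 1)"
proof (rule generates_units_iff)
  show q: "CARD('a) - 1 > 0" using one_less_card_field[where 'a = 'a] by simp
  have "c * c ^ (CARD('a) - 1) = c"
    using q finite_field_power_card_eq_same[of c] by (simp flip: power_Suc)
  then show "c ^ (CARD('a) - 1) = 1" using assms by simp
qed (use assms in \<open>auto simp: card_Diff_singleton\<close>)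

section \<open>Evaluation of least common multiples and Lucas polynomials\<close>

lemma eval2_mult: "eval2 (F * G) b c = eval2 F b c * eval2 G b c"
  by (simp add: eval2_def)

lemma eval2_prod: "eval2 (prod F A) b c = (\<Prod>i\<in>A. eval2 (F i) b c)"
  by (simp add: eval2_def poly_prod)

text \<open>Evaluation is multiplicative, so nonvanishing passes to divisors. The lcm is a multiple
  of each member of \<open>A\<close> and a divisor of their product, which settles both directions
  without computing it.\<close>

lemma eval2_Lcm_nonzero_iff:
  fixes A :: "'a::field_gcd poly poly set"
  assumes "finite A"
  shows "eval2 (Lcm A) b c \<noteq> 0 \<longleftrightarrow> (\<forall>F\<in>A. eval2 F b c \<noteq> 0)"
proof
  assume "eval2 (Lcm A) b c \<noteq> 0"
  then show "\<forall>F\<in>A. eval2 F b c \<noteq> 0"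
    by (metis dvd_Lcm dvdE eval2_mult mult_zero_left)
next
  assume A: "\<forall>F\<in>A. eval2 F b c \<noteq> 0"
  have "Lcm A dvd \<Prod>A" using assms by (intro Lcm_least dvd_prodI) auto
  moreover have "eval2 (\<Prod>A) b c \<noteq> 0"
    using A assms by (simp add: eval2_prod[of "\<lambda>F. F"])
  ultimately show "eval2 (Lcm A) b c \<noteq> 0"
    by (metis dvdE eval2_mult mult_zero_left)
qed

text \<open>The power sums of the two roots of X^2 + bX + c obey the Lucas recurrence with the same
  initial values. They are formed in the closure because the roots need not lie in the base
  field.\<close>

lemma to_ac_eval2_lucas_V:
  fixes b c :: "'a::field"
  assumes "x + y = - to_ac b" "x * y = to_ac c"
  shows "to_ac (eval2 (lucas_V n) b c) = x ^ n + y ^ n"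
proof (induction n rule: lucas_V.induct)
  case 1
  have "eval2 (2 :: 'a poly poly) b c = 2"
    unfolding eval2_def one_add_one[symmetric] poly_add poly_1 by (rule refl)
  then show ?case by simp
next
  case 2
  then show ?case using assms by (simp add: eval2_def)
next
  case (3 n)
  have "eval2 (lucas_V (Suc (Suc n))) b c =
      - b * eval2 (lucas_V (Suc n)) b c - c * eval2 (lucas_V n) b c"
    by (simp add: eval2_def)
  then have "to_ac (eval2 (lucas_V (Suc (Suc n))) b c) =
      (x + y) * (x ^ Suc n + y ^ Suc n) - x * y * (x ^ n + y ^ n)"
    using 3 assms by simp
  then show ?case by (simp add: algebra_simps)
qed

section \<open>The Frobenius map on the algebraic closure\<close>

lemma power_card_in_range_to_ac:
  fixes x :: "'a::finite_field alg_closure"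
  assumes "x ^ CARD('a) = x"
  shows "x \<in> range to_ac"
proof -
  let ?P = "monom 1 CARD('a) - monom 1 1 :: 'a alg_closure poly"
  have q: "CARD('a) > 1" by (rule one_less_card_field)
  then have "coeff ?P CARD('a) = 1" by simp
  then have nz: "?P \<noteq> 0" by (metis coeff_0 zero_neq_one)
  have deg: "degree ?P \<le> CARD('a)"
    using q by (intro degree_diff_le) (auto simp: degree_monom_eq)
  \<comment> \<open>X^q - X has at most q roots, and the q elements of the base field are already
    roots, so there are no others.\<close>
  have "card {x. poly ?P x = 0} \<le> CARD('a)"
    using card_poly_roots_bound[OF nz] deg by simp
  also have "\<dots> = card (range (to_ac :: 'a \<Rightarrow> _))" by (rule card_image[OF inj_to_ac, symmetric])
  finally have "card {x. poly ?P x = 0} \<le> card (range (to_ac :: 'a \<Rightarrow> _))" .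
  moreover have "range to_ac \<subseteq> {x. poly ?P x = 0}"
    by (auto simp: poly_monom finite_field_power_card_eq_same simp flip: to_ac_power)
  ultimately have "range to_ac = {x. poly ?P x = 0}"
    using poly_roots_finite[OF nz] by (intro card_seteq) auto
  then show ?thesis using assms by (auto simp: poly_monom)
qed

lemma power_card_add:
  fixes x y :: "'a::finite_field alg_closure"
  assumes "CARD('a) = r ^ k" "prime r"
  shows "(x + y) ^ CARD('a) = x ^ CARD('a) + y ^ CARD('a)"
proof -
  have "CHAR('a) dvd r ^ k" using CHAR_dvd_CARD[where 'a = 'a] assms(1) by simp
  then have "CHAR('a) = r"
    using assms(2) by (metis CHAR_prime prime_dvd_power primes_dvd_imp_eq)
  then show ?thesis
    using assms by (intro freshmans_dream'[of _ k]) simp_all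
qed

section \<open>Roots of irreducible polynomials in the closure\<close>

lemma map_poly_to_ac_add: "map_poly to_ac (g + h) = map_poly to_ac g + map_poly to_ac h"
  by (rule poly_eqI) (simp add: coeff_map_poly)

lemma map_poly_to_ac_mult: "map_poly to_ac (g * h) = map_poly to_ac g * map_poly to_ac h"
  by (rule poly_eqI) (simp add: coeff_map_poly coeff_mult to_ac_sum)

text \<open>A nonzero \<open>g\<close> of smaller degree is coprime to the irreducible
  \<open>f\<close>. If both vanished at \<open>x\<close>, so would their Bezout combination, which
  is 1.\<close>

lemma is_minimal_poly_iff_root:
  fixes f :: "'a::field_gcd poly"
  assumes "irreducible f" "lead_coeff f = 1"
  shows "is_minimal_poly f x \<longleftrightarrow> poly (map_poly to_ac f) x = 0"
proof -
  have "degree f \<le> degree g"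
    if root: "poly (map_poly to_ac f) x = 0" and g: "g \<noteq> 0" "poly (map_poly to_ac g) x = 0" for g
  proof (rule ccontr)
    assume "\<not> degree f \<le> degree g"
    then have "\<not> f dvd g" using g(1) dvd_imp_degree_le by blast
    then have "coprime f g"
      using assms(1) by (intro prime_elem_imp_coprime irreducible_imp_prime_elem_gcd)
    then obtain u v where "u * f + v * g = 1"
      by (metis bezout_coefficients_fst_snd coprime_imp_gcd_eq_1)
    then have "poly (map_poly to_ac (u * f + v * g)) x = 1" by simp
    then show False using root g(2) by (simp add: map_poly_to_ac_add map_poly_to_ac_mult)
  qed
  then show ?thesis using assms(2) by (auto simp: is_minimal_poly_def)
qed

lemma irreducible_quadratic_no_root:
  fixes b c a :: "'a::field"
  assumes "irreducible [:c, b, 1:]"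
  shows "poly [:c, b, 1:] a \<noteq> 0"
proof
  assume "poly [:c, b, 1:] a = 0"
  then have "[:- a, 1:] dvd [:c, b, 1:]" by (simp only: poly_eq_0_iff_dvd)
  then obtain h where h: "[:c, b, 1:] = [:- a, 1:] * h" by blast
  then have "h \<noteq> 0" by auto
  then have "degree h = 1" using arg_cong[OF h, of degree] by (subst (asm) degree_mult_eq) auto
  moreover have "is_unit [:- a, 1:] \<or> is_unit h" using irreducibleD[OF assms h] .
  ultimately show False using \<open>h \<noteq> 0\<close> by (auto simp: is_unit_iff_degree)
qed

text \<open>Frobenius fixes the coefficients, so it maps \<open>x\<close> to a root. Subtracting the
  two root equations leaves only \<open>x\<close> itself or the conjugate
  \<open>- to_ac b - x\<close>; the former would put \<open>x\<close> in the base field, where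
  \<open>f\<close> has no root.\<close>

lemma conjugate_root:
  fixes b c :: "'a::finite_field"
  assumes "CARD('a) = r ^ k" "prime r" "irreducible [:c, b, 1:]"
    and root: "x\<^sup>2 + to_ac b * x + to_ac c = 0"
  shows "x ^ CARD('a) = - to_ac b - x"
proof -
  let ?q = "CARD('a)"
  have to_ac_q: "to_ac a ^ ?q = to_ac a" for a :: 'a
    by (simp add: finite_field_power_card_eq_same flip: to_ac_power)
  have "(x\<^sup>2 + to_ac b * x + to_ac c) ^ ?q = (x ^ ?q)\<^sup>2 + to_ac b * x ^ ?q + to_ac c"
    by (simp add: power_card_add[OF assms(1,2)] power_mult_distrib to_ac_q power2_eq_square)
  then have xq: "(x ^ ?q)\<^sup>2 + to_ac b * x ^ ?q + to_ac c = 0"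
    using root by (simp add: power_0_left)
  then have "(x ^ ?q - x) * (x ^ ?q + x + to_ac b) = 0"
  proof -
    have "(x ^ ?q - x) * (x ^ ?q + x + to_ac b) =
        ((x ^ ?q)\<^sup>2 + to_ac b * x ^ ?q + to_ac c) - (x\<^sup>2 + to_ac b * x + to_ac c)"
      by (simp add: power2_eq_square algebra_simps)
    then show ?thesis using xq root by simp
  qed
  moreover have "x ^ ?q \<noteq> x"
  proof
    assume "x ^ ?q = x"
    then obtain a where "x = to_ac a" using power_card_in_range_to_ac[of x] by auto
    with root have "to_ac (a\<^sup>2 + b * a + c) = 0" by simp
    then have "a\<^sup>2 + b * a + c = 0" by (simp only: to_ac_eq_0_iff)
    then have "poly [:c, b, 1:] a = 0" by (simp add: power2_eq_square algebra_simps)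
    then show False using irreducible_quadratic_no_root[OF assms(3)] by blast
  qed
  ultimately have "x ^ ?q + x + to_ac b = 0" by simp
  then show ?thesis by (simp add: eq_diff_eq add_eq_0_iff2)
qed

section \<open>Generators of the quadratic extension and the primitivity criterion\<close>

lemma generates_quadratic_ext_iff:
  fixes x :: "'a::finite_field alg_closure"
  assumes "x \<in> quadratic_ext" "x \<noteq> 0"
  shows "generates_units quadratic_ext x \<longleftrightarrow>
    (\<forall>l. prime l \<and> l dvd CARD('a)\<^sup>2 - 1 \<longrightarrow> x ^ ((CARD('a)\<^sup>2 - 1) div l) \<noteq> 1)"
proof (rule generates_units_iff)
  let ?Q = "CARD('a)\<^sup>2"
  have Q: "?Q > 1" using one_less_card_field by (intro one_less_power) auto
  then show "?Q - 1 > 0" by simp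
  have "(0 :: 'a alg_closure) \<in> quadratic_ext" by (simp add: quadratic_ext_def)
  then show "card ((quadratic_ext :: 'a alg_closure set) - {0}) = ?Q - 1"
    by (simp add: card_Diff_singleton card_quadratic_ext)
  have xQ: "x ^ ?Q = x" using assms(1) by (simp add: quadratic_ext_def)
  then have "x * x ^ (?Q - 1) = x" using Q by (simp flip: power_Suc)
  then show "x ^ (?Q - 1) = 1" using assms(2) by simp
  have "(x powi i) ^ ?Q = x powi i" for i :: int
  proof -
    have "(x powi i) ^ ?Q = x powi (int ?Q * i)"
      by (simp only: power_int_power' mult.commute)
    also have "\<dots> = (x ^ ?Q) powi i" by (simp only: power_int_mult power_int_of_nat)
    finally show ?thesis using xQ by simp
  qed
  then show "range (\<lambda>i::int. x powi i) \<subseteq> quadratic_ext - {0}"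
    using assms(2) by (auto simp: quadratic_ext_def)
qed

theorem proposition5p6:
  fixes q r k m s :: nat
    and p e :: "nat \<Rightarrow> nat"
    and b c :: "'a::{finite_field, field_gcd}"
  assumes "CARD('a) = q" and "q = r ^ k" and "prime r" and "odd r" and "k > 0"
    and "q + 1 = 2 ^ m * (\<Prod>i=1..s. p i ^ e i)"
    and "m > 0"
    and "\<And>i. i \<in> {1..s} \<Longrightarrow> prime (p i) \<and> odd (p i) \<and> e i > 0"
    and "inj_on p {1..s}"
    and "irreducible [:c, b, 1:]"
    and "primitive_element c"
  shows "primitive_quadratic [:c, b, 1:] \<longleftrightarrow> eval2 (E_poly (q + 1) p s) b c \<noteq> 0"
proof -
  let ?f = "[:c, b, 1:]"
  have q: "q > 1" using one_less_card_field[where 'a = 'a] assms(1) by simp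
  have "odd q" using assms(2,4) by simp
  have c0: "c \<noteq> 0"
    using irreducible_quadratic_no_root[OF assms(10), of 0] by simp
  have c_prim: "c ^ ((q - 1) div l) \<noteq> 1" if "prime l" "l dvd q - 1" for l
    using primitive_element_iff[OF c0] assms(1,11) that by auto
  \<comment> \<open>This power is a square root of 1, and primitivity of \<open>c\<close> tested at
    the prime 2 excludes the value 1.\<close>
  have c_half: "c ^ ((q - 1) div 2) = -1"
  proof -
    have "c * c ^ (q - 1) = c"
      using q finite_field_power_card_eq_same[of c] assms(1) by (simp flip: power_Suc)
    then have "c ^ (q - 1) = 1" using c0 by simp
    moreover have "(q - 1) div 2 * 2 = q - 1" using \<open>odd q\<close> by simp
    ultimately have "(c ^ ((q - 1) div 2))\<^sup>2 = 1" by (simp flip: power_mult)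
    then show ?thesis
      using c_prim[of 2] \<open>odd q\<close> by (auto simp: power2_eq_1_iff)
  qed
  have Q: "q\<^sup>2 - 1 = (q + 1) * (q - 1)"
    by (simp add: power2_eq_square algebra_simps)
  \<comment> \<open>The right-hand side does not mention \<open>x\<close>, so either root of
    \<open>f\<close> may serve as the witness for primitivity.\<close>
  have root_iff: "generates_units quadratic_ext x \<longleftrightarrow> eval2 (E_poly (q + 1) p s) b c \<noteq> 0"
    if "poly (map_poly to_ac ?f) x = 0" for x
  proof -
    have root: "x\<^sup>2 + to_ac b * x + to_ac c = 0"
      using that by (simp add: map_poly_pCons power2_eq_square algebra_simps)
    have xq: "x ^ q = - to_ac b - x"
      using conjugate_root[OF _ assms(3,10) root] assms(1,2) by simp
    have sum: "x + x ^ q = - to_ac b" unfolding xq by simp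
    have "x * (- to_ac b - x) = to_ac c - (x\<^sup>2 + to_ac b * x + to_ac c)"
      by (simp add: power2_eq_square algebra_simps)
    also have "\<dots> = to_ac c" using root by simp
    finally have "x * (- to_ac b - x) = to_ac c" .
    then have prod: "x * x ^ q = to_ac c" unfolding xq .
    have x0: "x \<noteq> 0" using prod c0 by auto
    have norm: "x ^ (q + 1) = to_ac c" using prod by simp
    have "(x ^ q) ^ q = x"
    proof -
      \<comment> \<open>The trace \<open>x ^ q + x\<close> lies in the base field and is fixed by
        Frobenius; cancelling \<open>x ^ q\<close> leaves the claim.\<close>
      have "(x ^ q + x) ^ q = (x ^ q) ^ q + x ^ q"
        using power_card_add[of r k "x ^ q" x] assms(1-3) by simp
      moreover have "(x ^ q + x) ^ q = x ^ q + x"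
      proof -
        have "x ^ q + x = to_ac (- b)" using sum by (simp add: add.commute)
        then show ?thesis
          using finite_field_power_card_eq_same[of "- b"] assms(1) by (metis to_ac_power)
      qed
      ultimately show ?thesis by simp
    qed
    then have xQ: "x \<in> quadratic_ext"
      using assms(1) by (simp add: quadratic_ext_def power2_eq_square power_mult)
    \<comment> \<open>The exponent keeps the full factor q + 1, and \<open>x ^ (q + 1)\<close> is
      the norm \<open>c\<close>, so the test descends to the base field.\<close>
    have norm_ne: "x ^ ((q\<^sup>2 - 1) div l) \<noteq> 1" if l: "prime l" "l dvd q - 1" for l
    proof -
      have "(q\<^sup>2 - 1) div l = (q + 1) * ((q - 1) div l)"
        unfolding Q using l(2) by (rule div_mult_swap[symmetric])
      then have "x ^ ((q\<^sup>2 - 1) div l) = to_ac (c ^ ((q - 1) div l))"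
        by (simp only: power_mult norm to_ac_power)
      then show ?thesis using c_prim[OF l] by (simp del: to_ac_power)
    qed
    have V_iff: "eval2 (lucas_V ((q + 1) div (2 * l))) b c \<noteq> 0 \<longleftrightarrow> x ^ ((q\<^sup>2 - 1) div l) \<noteq> 1"
      if l: "prime l" "odd l" "l dvd q + 1" for l
    proof -
      have "2 * l dvd q + 1" using l \<open>odd q\<close> by (intro divides_mult) auto
      then obtain n where n: "q + 1 = 2 * l * n" by blast
      have nn: "(q + 1) div (2 * l) = n" using n prime_gt_0_nat[OF l(1)] by simp
      have ql: "(q\<^sup>2 - 1) div l = n * (q - 1) * 2"
        unfolding Q n using prime_gt_0_nat[OF l(1)] by (simp add: mult.assoc)
      \<comment> \<open>Since q + 1 = 2ln, the exponent is (q^2 - 1)/(2l), and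
        \<open>y\<^sup>2\<close> is the power of \<open>x\<close> tested at the prime
        \<open>l\<close>.\<close>
      define y where "y = x ^ (n * (q - 1))"
      have "to_ac (eval2 (lucas_V n) b c) = x ^ n + (x ^ q) ^ n"
        by (rule to_ac_eval2_lucas_V[OF sum prod])
      also have "(x ^ q) ^ n = x ^ (n + n * (q - 1))"
      proof -
        have "q * n = n + n * (q - 1)" using q by (simp add: algebra_simps)
        then show ?thesis by (metis power_mult)
      qed
      also have "x ^ n + x ^ (n + n * (q - 1)) = x ^ n * (1 + y)"
        by (simp add: y_def power_add algebra_simps)
      finally have V0: "eval2 (lucas_V n) b c = 0 \<longleftrightarrow> y = -1"
        using x0 by (metis add_eq_0_iff mult_eq_0_iff power_not_zero to_ac_eq_0_iff)
      have "y ^ l = -1"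
      proof -
        have "(q - 1) div 2 * 2 = q - 1" using \<open>odd q\<close> by simp
        then have "n * (q - 1) * l = (q + 1) * ((q - 1) div 2)" unfolding n
          by (metis mult.assoc mult.commute)
        then have "y ^ l = to_ac (c ^ ((q - 1) div 2))"
          unfolding y_def by (metis norm power_mult to_ac_power)
        then show ?thesis unfolding c_half by simp
      qed
      \<comment> \<open>Oddness of \<open>l\<close> enters here: together with
        \<open>y ^ l = -1\<close> it turns \<open>y\<^sup>2 = 1\<close> into
        \<open>y = -1\<close>.\<close>
      moreover have "y ^ l = y" if "y\<^sup>2 = 1"
      proof -
        obtain j where "l = 2 * j + 1" using l(2) by (elim oddE)
        then show ?thesis using that by (simp add: power_mult)
      qed
      ultimately have "y = -1 \<longleftrightarrow> y\<^sup>2 = 1" by auto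
      moreover have "x ^ ((q\<^sup>2 - 1) div l) = y\<^sup>2" unfolding ql y_def by (rule power_mult)
      ultimately show ?thesis using V0 nn by simp
    qed
    have dvd_iff: "(\<exists>i\<in>{1..s}. l = p i) \<longleftrightarrow> odd l \<and> l dvd q + 1" if l: "prime l" for l
    proof
      assume "\<exists>i\<in>{1..s}. l = p i"
      then obtain i where i: "i \<in> {1..s}" "l = p i" by auto
      then have "l dvd p i ^ e i" using assms(8)[of i] by simp
      also have "\<dots> dvd (\<Prod>i=1..s. p i ^ e i)" using i by (intro dvd_prodI) auto
      also have "\<dots> dvd q + 1" unfolding assms(6) by simp
      finally show "odd l \<and> l dvd q + 1" using assms(8)[of i] i by simp
    next
      assume A: "odd l \<and> l dvd q + 1"
      have "\<not> l dvd 2 ^ m"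
        using A l by (metis prime_dvd_power primes_dvd_imp_eq two_is_prime_nat even_numeral dvd_refl)
      then have "l dvd (\<Prod>i=1..s. p i ^ e i)"
        using A l unfolding assms(6) by (simp add: prime_dvd_mult_iff)
      then obtain i where i: "i \<in> {1..s}" "l dvd p i ^ e i"
        using l by (auto simp: prime_dvd_prod_iff)
      then have "l = p i"
        using l assms(8)[of i] by (meson prime_dvd_power primes_dvd_imp_eq)
      then show "\<exists>i\<in>{1..s}. l = p i" using i(1) by blast
    qed
    have "generates_units quadratic_ext x \<longleftrightarrow>
        (\<forall>l. prime l \<and> l dvd q\<^sup>2 - 1 \<longrightarrow> x ^ ((q\<^sup>2 - 1) div l) \<noteq> 1)"
      using generates_quadratic_ext_iff[OF xQ x0] assms(1) by simp
    also have "\<dots> \<longleftrightarrow> (\<forall>l. prime l \<and> odd l \<and> l dvd q + 1 \<longrightarrow> x ^ ((q\<^sup>2 - 1) div l) \<noteq> 1)"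
    proof -
      \<comment> \<open>The prime 2 divides both factors of q^2 - 1; it is counted with q - 1, where
        \<open>norm_ne\<close> disposes of it.\<close>
      have "l dvd q - 1 \<or> odd l \<and> l dvd q + 1 \<longleftrightarrow> l dvd q\<^sup>2 - 1" if "prime l" for l
      proof (cases "even l")
        case True
        then have "l = 2" using that by (metis primes_dvd_imp_eq two_is_prime_nat)
        then show ?thesis using \<open>odd q\<close> by (simp add: Q)
      next
        case False
        then show ?thesis using that unfolding Q by (subst prime_dvd_mult_iff) auto
      qed
      then show ?thesis using norm_ne by blast
    qed
    also have "\<dots> \<longleftrightarrow> (\<forall>i\<in>{1..s}. x ^ ((q\<^sup>2 - 1) div p i) \<noteq> 1)"
      using dvd_iff assms(8) by metis
    also have "\<dots> \<longleftrightarrow> (\<forall>i\<in>{1..s}. eval2 (lucas_V ((q + 1) div (2 * p i))) b c \<noteq> 0)"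
      using dvd_iff V_iff assms(8) by (intro ball_cong) metis+
    also have "\<dots> \<longleftrightarrow> eval2 (E_poly (q + 1) p s) b c \<noteq> 0"
      unfolding E_poly_def by (subst eval2_Lcm_nonzero_iff) auto
    finally show ?thesis .
  qed
  have "degree (map_poly to_ac ?f) = 2" by (simp add: map_poly_pCons)
  \<comment> \<open>This root is the witness for primitivity in the direction from nonvanishing of
    \<open>E_poly\<close>.\<close>
  then obtain x0 where x0: "poly (map_poly to_ac ?f) x0 = 0"
    using alg_closed_imp_poly_has_root[of "map_poly to_ac ?f"] by auto
  have "primitive_quadratic ?f \<longleftrightarrow>
      (\<exists>x. generates_units quadratic_ext x \<and> poly (map_poly to_ac ?f) x = 0)"
    unfolding primitive_quadratic_def using is_minimal_poly_iff_root[OF assms(10)] by simp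
  then show ?thesis using root_iff x0 by blast
qed

end
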